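(* Let $p\ge1$. For every $t\ge0$ let $0<m_t\le L_t$, $\sigma_t\ge0$, $\delta_t>0$, $\alpha_t\ge0$. Consider the inexact online gradient descent iteration $x_{t+1}=x_t-\alpha_t(\nabla f_t(x_t)+v_t)$ in $\mathbb R^p$. For all $t$ assume: (i) $f_t\in\mathcal S(m_t,L_t)$ with global minimizer $x_t^*$; (ii) $\|x_{t+1}^*-x_t^*\|\le\sigma_t$; (iii) $\|v_t\|\le\delta_t\|\nabla f_t(x_t)\|$. If there exist non-negative scalars $(\rho_t,\lambda_t^{(1)},\lambda_t^{(2)},\lambda_t^{(3)})$ such that $$\begin{bmatrix}1-\rho_t^2-2\lambda_t^{(1)}L_tm_t & -\alpha_t+\lambda_t^{(1)}(L_t+m_t) & 1 & -\alpha_t\\ -\alpha_t+\lambda_t^{(1)}(L_t+m_t) & \alpha_t^2-2\lambda_t^{(1)}+\delta_t^2\lambda_t^{(3)} & -\alpha_t & \alpha_t^2\\ 1 & -\alpha_t & 1-\lambda_t^{(2)} & -\alpha_t\\ -\alpha_t & \alpha_t^2 & -\alpha_t & \alpha_t^2-\lambda_t^{(3)}\end{bmatrix}\preceq 0,$$ then $\|x_{t+1}-x_{t+1}^*\|^2\le\rho_t^2\|x_t-x_t^*\|^2+\lambda_t^{(2)}\sigma_t^2$.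
   Context: $\mathcal S(m,L)$ is the set of differentiable functions $f:\mathbb R^p\to\mathbb R$ having a unique global minimizer $x^*$ such that for all $x\in\mathbb R^p$ $$\begin{bmatrix}x-x^*\\ \nabla f(x)\end{bmatrix}^T\begin{bmatrix}-2mLI_p&(L+m)I_p\\(L+m)I_p&-2I_p\end{bmatrix}\begin{bmatrix}x-x^*\\ \nabla f(x)\end{bmatrix}\ge0.$$ $P\preceq0$ means the symmetric matrix $P$ is negative semidefinite; norms are Euclidean. *)

theory Defs
  imports "HOL-Analysis.Analysis"
begin

text \<open>
  The underspecified value of \<open>THE\<close> plays no role below: every function whose gradient
  is used is differentiable, and then the gradient exists (\<open>GDERIV_gradient\<close>).
\<close>

definition gradient :: "('a::real_inner \<Rightarrow> real) \<Rightarrow> 'a \<Rightarrow> 'a" where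
  "gradient f x = (THE D. GDERIV f x :> D)"

lemma GDERIV_gradient:
  fixes f :: "'a::euclidean_space \<Rightarrow> real"
  assumes "f differentiable (at x)"
  shows "GDERIV f x :> gradient f x"
proof -
  obtain f' where f': "(f has_derivative f') (at x)"
    using assms unfolding differentiable_def by blast
  then interpret bounded_linear f' by (rule has_derivative_bounded_linear)
  have "f' h = h \<bullet> (\<Sum>b\<in>Basis. f' b *\<^sub>R b)" for h
  proof -
    have "f' h = f' (\<Sum>b\<in>Basis. (h \<bullet> b) *\<^sub>R b)" by (simp add: euclidean_representation)
    also have "\<dots> = (\<Sum>b\<in>Basis. (h \<bullet> b) * f' b)" by (simp add: sum scaleR)
    finally show ?thesis by (simp add: inner_sum_right mult.commute)
  qed
  then have D: "GDERIV f x :> (\<Sum>b\<in>Basis. f' b *\<^sub>R b)"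
    using f' unfolding gderiv_def by (metis (no_types, lifting) ext)
  moreover have "D1 = D2" if "GDERIV f x :> D1" "GDERIV f x :> D2" for D1 D2
  proof -
    have "(\<lambda>h. h \<bullet> D1) = (\<lambda>h. h \<bullet> D2)"
      using that unfolding gderiv_def by (rule has_derivative_unique)
    then show ?thesis by (meson vector_eq_ldot)
  qed
  ultimately show ?thesis
    unfolding gradient_def by (metis theI)
qed

definition global_minimizer :: "('a \<Rightarrow> real) \<Rightarrow> 'a \<Rightarrow> bool" where
  "global_minimizer f z \<longleftrightarrow> (\<forall>y. f z \<le> f y)"

definition stack :: "real ^ 'p \<Rightarrow> real ^ 'q \<Rightarrow> real ^ ('p::finite + 'q::finite)" where
  "stack u w = (\<chi> i. case i of Inl k \<Rightarrow> u $ k | Inr k \<Rightarrow> w $ k)"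

definition block_matrix ::
  "real ^ 'p ^ 'p \<Rightarrow> real ^ 'q ^ 'p \<Rightarrow> real ^ 'p ^ 'q \<Rightarrow> real ^ 'q ^ 'q \<Rightarrow> real ^ ('p::finite + 'q::finite) ^ ('p + 'q)" where
  "block_matrix A B C D = (\<chi> i j. case i of
       Inl k \<Rightarrow> (case j of Inl l \<Rightarrow> A $ k $ l | Inr l \<Rightarrow> B $ k $ l)
     | Inr k \<Rightarrow> (case j of Inl l \<Rightarrow> C $ k $ l | Inr l \<Rightarrow> D $ k $ l))"

definition sector_matrix :: "real \<Rightarrow> real \<Rightarrow> real ^ ('p::finite + 'p) ^ ('p + 'p)" where
  "sector_matrix m L = block_matrix
     ((- 2 * m * L) *\<^sub>R mat 1) ((L + m) *\<^sub>R mat 1)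
     ((L + m) *\<^sub>R mat 1)       ((- 2) *\<^sub>R mat 1)"

text \<open>
  Exactly one \<open>z\<close> is a global minimizer, so the quantification over \<open>z\<close> in the last conjunct
  only names it.
\<close>

definition sector_class :: "real \<Rightarrow> real \<Rightarrow> (real ^ 'p \<Rightarrow> real) set" where
  "sector_class m L = {f. (\<forall>x. f differentiable (at x)) \<and>
     (\<exists>!z. global_minimizer f z) \<and>
     (\<forall>z. global_minimizer f z \<longrightarrow>
       (\<forall>x. stack (x - z) (gradient f x) \<bullet>
             (sector_matrix m L *v stack (x - z) (gradient f x)) \<ge> 0))}"

definition neg_semidef :: "real ^ 'n ^ 'n \<Rightarrow> bool" where
  "neg_semidef A \<longleftrightarrow> transpose A = A \<and> (\<forall>w. w \<bullet> (A *v w) \<le> 0)"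

end

theory Submission
  imports Defs
begin

text \<open>
  The next error is \<open>x\<^sub>t - x\<^sub>t\<^sup>* - \<alpha>\<^sub>t \<nabla>f\<^sub>t(x\<^sub>t) + (x\<^sub>t\<^sup>* - x\<^sub>t\<^sub>+\<^sub>1\<^sup>*) - \<alpha>\<^sub>t v\<^sub>t\<close>. The matrix inequality, applied to each
  coordinate of its four ingredients and summed, is an S-procedure certificate: the multipliers
  weight the sector inequality, the drift bound and the bound on the gradient error.
\<close>

lemma sum_UNIV_sum:
  fixes h :: "'a::finite + 'b::finite \<Rightarrow> 'c::comm_monoid_add"
  shows "(\<Sum>i\<in>UNIV. h i) = (\<Sum>k\<in>UNIV. h (Inl k)) + (\<Sum>k\<in>UNIV. h (Inr k))"
proof -
  have "sum h (UNIV <+> UNIV) = sum (h \<circ> Inl) UNIV + sum (h \<circ> Inr) UNIV"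
    by (rule sum.Plus) simp_all
  then show ?thesis
    by simp
qed

lemma inner_stack: "stack a b \<bullet> stack c d = a \<bullet> c + b \<bullet> d"
  by (simp add: inner_vec_def sum_UNIV_sum stack_def)

text \<open>Together with \<open>inner_stack\<close>, this reduces a quadratic form in dimension 2p
  to inner products of p-vectors, with no indices over the sum type left.\<close>

lemma block_matrix_mult_stack:
  "block_matrix A B C D *v stack u w = stack (A *v u + B *v w) (C *v u + D *v w)"
  by (auto simp: vec_eq_iff matrix_vector_mult_def sum_UNIV_sum stack_def block_matrix_def
      split: sum.split)

text \<open>All four blocks are multiples of the identity, so only the two squared norms and one
  inner product survive; the equal off-diagonal blocks each contribute one copy of the cross
  term.\<close>

lemma sector_form:
  fixes y g :: "real ^ 'p"
  shows "stack y g \<bullet> (sector_matrix m L *v stack y g)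
     = - 2 * m * L * (norm y)\<^sup>2 + 2 * (L + m) * (y \<bullet> g) - 2 * (norm g)\<^sup>2"
proof -
  have scaled_id: "(c *\<^sub>R mat 1) *v u = c *\<^sub>R u" for c :: real and u :: "real ^ 'p"
    by (simp add: scaleR_matrix_vector_assoc[symmetric])
  show ?thesis
    unfolding sector_matrix_def block_matrix_mult_stack inner_stack scaled_id
    by (simp add: inner_simps inner_commute power2_norm_eq_inner algebra_simps)
qed

lemma vector_4 [simp]:
  "(vector [a, b, c, d] :: 'a::zero ^ 4) $ 1 = a"
  "(vector [a, b, c, d] :: 'a ^ 4) $ 2 = b"
  "(vector [a, b, c, d] :: 'a ^ 4) $ 3 = c"
  "(vector [a, b, c, d] :: 'a ^ 4) $ 4 = d"
  unfolding vector_def by simp_all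

lemma neg_semidef_4_form:
  fixes a b c d :: real
  assumes "neg_semidef (vector
        [vector [p11, p12, p13, p14],
         vector [p21, p22, p23, p24],
         vector [p31, p32, p33, p34],
         vector [p41, p42, p43, p44]] :: real ^ 4 ^ 4)"
  shows "a * (p11 * a + p12 * b + p13 * c + p14 * d) + b * (p21 * a + p22 * b + p23 * c + p24 * d)
    + c * (p31 * a + p32 * b + p33 * c + p34 * d) + d * (p41 * a + p42 * b + p43 * c + p44 * d) \<le> 0"
proof -
  have "(vector [a, b, c, d] :: real ^ 4) \<bullet> (vector
        [vector [p11, p12, p13, p14],
         vector [p21, p22, p23, p24],
         vector [p31, p32, p33, p34],
         vector [p41, p42, p43, p44]] *v (vector [a, b, c, d] :: real ^ 4)) \<le> 0"
    using assms unfolding neg_semidef_def by blast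
  then show ?thesis
    by (simp add: inner_vec_def matrix_vector_mult_def sum_4)
qed

text \<open>The matrix is the rank-one matrix of the vector \<open>(1, -a, 1, -a)\<close>, which
  produces the squared norm of the new error, plus the matrices of the remaining terms with their
  weights. No term couples different coordinates, so a 4 by 4 matrix suffices in every dimension
  p.\<close>

lemma one_step_form_nonpos:
  fixes y g d w :: "real ^ 'p" and a r l1 l2 l3 m L \<delta> :: real
  assumes "neg_semidef (vector
        [vector [1 - r\<^sup>2 - 2 * l1 * L * m, - a + l1 * (L + m), 1, - a],
         vector [- a + l1 * (L + m), a\<^sup>2 - 2 * l1 + \<delta>\<^sup>2 * l3, - a, a\<^sup>2],
         vector [1, - a, 1 - l2, - a],
         vector [- a, a\<^sup>2, - a, a\<^sup>2 - l3]] :: real ^ 4 ^ 4)"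
  shows "(norm (y - a *\<^sub>R g + d - a *\<^sub>R w))\<^sup>2 - r\<^sup>2 * (norm y)\<^sup>2
    + l1 * (- 2 * m * L * (norm y)\<^sup>2 + 2 * (L + m) * (y \<bullet> g) - 2 * (norm g)\<^sup>2)
    - l2 * (norm d)\<^sup>2 + l3 * (\<delta>\<^sup>2 * (norm g)\<^sup>2 - (norm w)\<^sup>2) \<le> 0" (is "?Q \<le> 0")
proof -
  have "?Q = (\<Sum>i\<in>UNIV. (y $ i - a * g $ i + d $ i - a * w $ i)\<^sup>2 - r\<^sup>2 * (y $ i)\<^sup>2
      + l1 * (- 2 * m * L * (y $ i)\<^sup>2 + 2 * (L + m) * (y $ i * g $ i) - 2 * (g $ i)\<^sup>2)
      - l2 * (d $ i)\<^sup>2 + l3 * (\<delta>\<^sup>2 * (g $ i)\<^sup>2 - (w $ i)\<^sup>2))"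
    unfolding power2_norm_eq_inner inner_vec_def
    by (simp add: sum.distrib sum_subtractf sum_distrib_left[symmetric] power2_eq_square)
  also have "\<dots> \<le> 0"
  proof (rule sum_nonpos)
    fix i
    show "(y $ i - a * g $ i + d $ i - a * w $ i)\<^sup>2 - r\<^sup>2 * (y $ i)\<^sup>2
      + l1 * (- 2 * m * L * (y $ i)\<^sup>2 + 2 * (L + m) * (y $ i * g $ i) - 2 * (g $ i)\<^sup>2)
      - l2 * (d $ i)\<^sup>2 + l3 * (\<delta>\<^sup>2 * (g $ i)\<^sup>2 - (w $ i)\<^sup>2) \<le> 0"
      \<comment> \<open>The coordinate term is exactly the form of the matrix at
        \<open>(y $ i, g $ i, d $ i, w $ i)\<close>, so expanding both sides is enough.\<close>
      using neg_semidef_4_form[OF assms, of "y $ i" "g $ i" "d $ i" "w $ i"]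
      by (simp add: power2_eq_square algebra_simps)
  qed
  finally show ?thesis .
qed

theorem lemma3p3:
  fixes f :: "nat \<Rightarrow> real ^ 'p \<Rightarrow> real"
    and x v x_star :: "nat \<Rightarrow> real ^ 'p"
    and m L \<sigma> \<delta> \<alpha> \<rho> lam1 lam2 lam3 :: "nat \<Rightarrow> real"
  assumes params: "\<And>t. 0 < m t \<and> m t \<le> L t \<and> 0 \<le> \<sigma> t \<and> 0 < \<delta> t \<and> 0 \<le> \<alpha> t"
    and iteration: "\<And>t. x (Suc t) = x t - \<alpha> t *\<^sub>R (gradient (f t) (x t) + v t)"
    and sector: "\<And>t. f t \<in> sector_class (m t) (L t)"
    and minimizer: "\<And>t. global_minimizer (f t) (x_star t)"
    and drift: "\<And>t. norm (x_star (Suc t) - x_star t) \<le> \<sigma> t"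
    and inexact: "\<And>t. norm (v t) \<le> \<delta> t * norm (gradient (f t) (x t))"
  shows "\<forall>t. 0 \<le> \<rho> t \<and> 0 \<le> lam1 t \<and> 0 \<le> lam2 t \<and> 0 \<le> lam3 t \<and>
      neg_semidef (vector
        [vector [1 - (\<rho> t)\<^sup>2 - 2 * lam1 t * L t * m t, - \<alpha> t + lam1 t * (L t + m t), 1, - \<alpha> t],
         vector [- \<alpha> t + lam1 t * (L t + m t), (\<alpha> t)\<^sup>2 - 2 * lam1 t + (\<delta> t)\<^sup>2 * lam3 t, - \<alpha> t, (\<alpha> t)\<^sup>2],
         vector [1, - \<alpha> t, 1 - lam2 t, - \<alpha> t],
         vector [- \<alpha> t, (\<alpha> t)\<^sup>2, - \<alpha> t, (\<alpha> t)\<^sup>2 - lam3 t]] :: real ^ 4 ^ 4)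
    \<longrightarrow> (norm (x (Suc t) - x_star (Suc t)))\<^sup>2
          \<le> (\<rho> t)\<^sup>2 * (norm (x t - x_star t))\<^sup>2 + lam2 t * (\<sigma> t)\<^sup>2"
proof (intro allI impI, elim conjE)
  fix t
  \<comment> \<open>The drift \<open>?d\<close> runs from the new minimizer to the old one, so that
    it enters the new error with coefficient +1, as the third row of the matrix requires.\<close>
  let ?y = "x t - x_star t" and ?g = "gradient (f t) (x t)" and ?d = "x_star t - x_star (Suc t)"
  assume nonneg: "0 \<le> lam1 t" "0 \<le> lam2 t" "0 \<le> lam3 t"
    and lmi: "neg_semidef (vector
        [vector [1 - (\<rho> t)\<^sup>2 - 2 * lam1 t * L t * m t, - \<alpha> t + lam1 t * (L t + m t), 1, - \<alpha> t],
         vector [- \<alpha> t + lam1 t * (L t + m t), (\<alpha> t)\<^sup>2 - 2 * lam1 t + (\<delta> t)\<^sup>2 * lam3 t, - \<alpha> t, (\<alpha> t)\<^sup>2],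
         vector [1, - \<alpha> t, 1 - lam2 t, - \<alpha> t],
         vector [- \<alpha> t, (\<alpha> t)\<^sup>2, - \<alpha> t, (\<alpha> t)\<^sup>2 - lam3 t]] :: real ^ 4 ^ 4)"
  have "0 \<le> stack ?y ?g \<bullet> (sector_matrix (m t) (L t) *v stack ?y ?g)"
    \<comment> \<open>The sector inequality holds at whichever point is a global minimizer, hence at
      \<open>x_star t\<close>.\<close>
    using sector[of t] minimizer[of t] unfolding sector_class_def by blast
  then have "0 \<le> lam1 t * (- 2 * m t * L t * (norm ?y)\<^sup>2 + 2 * (L t + m t) * (?y \<bullet> ?g) - 2 * (norm ?g)\<^sup>2)"
    unfolding sector_form using nonneg(1) by (intro mult_nonneg_nonneg)
  moreover have "lam2 t * (norm ?d)\<^sup>2 \<le> lam2 t * (\<sigma> t)\<^sup>2"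
    using drift[of t] nonneg(2) by (intro mult_left_mono power_mono) (simp_all add: norm_minus_commute)
  moreover have "(norm (v t))\<^sup>2 \<le> (\<delta> t * norm ?g)\<^sup>2"
    using inexact[of t] by (intro power_mono) simp_all
  then have "0 \<le> lam3 t * ((\<delta> t)\<^sup>2 * (norm ?g)\<^sup>2 - (norm (v t))\<^sup>2)"
    using nonneg(3) by (simp add: power_mult_distrib)
  moreover have error_step: "x (Suc t) - x_star (Suc t) = ?y - \<alpha> t *\<^sub>R ?g + ?d - \<alpha> t *\<^sub>R v t"
    by (simp add: iteration scaleR_add_right)
  ultimately show "(norm (x (Suc t) - x_star (Suc t)))\<^sup>2
      \<le> (\<rho> t)\<^sup>2 * (norm ?y)\<^sup>2 + lam2 t * (\<sigma> t)\<^sup>2"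
    using one_step_form_nonpos[OF lmi, of ?y ?g ?d "v t"] unfolding error_step by linarith
qed

end
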